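(* Let $N$ be a normal subgroup of a group $G$. Let $g\in N$ be non-trivial and let $n\in t_G(g)$. Let $\nu:N\to\mathbb{R}_{\ge 0}$ be a $G$-invariant norm. If $\sup\{\nu([x,t]) : x\in G,\ t\in N\}<\infty$, then $$\overline{\nu}(g)\le\frac{n-2}{2n}\,\sup\{\nu([t,s]) : t,s\in N\}.$$
   Context: $[x,y]=xyx^{-1}y^{-1}$ and $g^x=xgx^{-1}$. For $g\in G$, $t_G(g)$ is the set of positive integers $n$ such that $g^{x_1}\cdots g^{x_n}=1$ for some $x_1,\dots,x_n\in G$. A function $\nu:N\to\mathbb{R}_{\ge0}$ is $G$-invariant if $\nu(gag^{-1})=\nu(a)$ for all $a\in N$, $g\in G$; it is a norm if $\nu(ab)\le\nu(a)+\nu(b)$ for all $a,b\in N$ (no other condition is required: $\nu$ need not be symmetric, $\nu(1)=0$ is not assumed, and $\nu(a)=0$ does not force $a=1$). The stabilization of $\nu$ is $\overline{\nu}(a)=\lim_{m\to\infty}\nu(a^m)/m$ for $a\in N$. *)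

theory Defs
  imports Complex_Main "HOL-Algebra.Coset"
begin

definition comm :: "('a, 'b) monoid_scheme \<Rightarrow> 'a \<Rightarrow> 'a \<Rightarrow> 'a" where
  "comm G x y = x \<otimes>\<^bsub>G\<^esub> y \<otimes>\<^bsub>G\<^esub> inv\<^bsub>G\<^esub> x \<otimes>\<^bsub>G\<^esub> inv\<^bsub>G\<^esub> y"

(* conj_by G x g is g^x; the conjugating element comes first *)
definition conj_by :: "('a, 'b) monoid_scheme \<Rightarrow> 'a \<Rightarrow> 'a \<Rightarrow> 'a" where
  "conj_by G x g = x \<otimes>\<^bsub>G\<^esub> g \<otimes>\<^bsub>G\<^esub> inv\<^bsub>G\<^esub> x"

definition t_set :: "('a, 'b) monoid_scheme \<Rightarrow> 'a \<Rightarrow> nat set" where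
  "t_set G g = {n. 0 < n \<and> (\<exists>xs. length xs = n \<and> set xs \<subseteq> carrier G \<and>
     foldr (\<otimes>\<^bsub>G\<^esub>) (map (\<lambda>x. conj_by G x g) xs) \<one>\<^bsub>G\<^esub> = \<one>\<^bsub>G\<^esub>)}"

(* A function N \<rightarrow> [0,\<infinity>) is a function on the whole type 'a of which only the values on N matter. *)
definition norm_on :: "('a, 'b) monoid_scheme \<Rightarrow> 'a set \<Rightarrow> ('a \<Rightarrow> real) \<Rightarrow> bool" where
  "norm_on G N \<nu> \<longleftrightarrow> (\<forall>a\<in>N. 0 \<le> \<nu> a) \<and>
     (\<forall>a\<in>N. \<forall>b\<in>N. \<nu> (a \<otimes>\<^bsub>G\<^esub> b) \<le> \<nu> a + \<nu> b)"

definition conj_invariant_on :: "('a, 'b) monoid_scheme \<Rightarrow> 'a set \<Rightarrow> ('a \<Rightarrow> real) \<Rightarrow> bool" where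
  "conj_invariant_on G N \<nu> \<longleftrightarrow> (\<forall>a\<in>N. \<forall>g\<in>carrier G. \<nu> (conj_by G g a) = \<nu> a)"

(* For a norm the limit exists, since m \<mapsto> \<nu> (a^m) is subadditive and nonnegative (Fekete). *)
definition stabilization :: "('a, 'b) monoid_scheme \<Rightarrow> ('a \<Rightarrow> real) \<Rightarrow> 'a \<Rightarrow> real" where
  "stabilization G \<nu> a = lim (\<lambda>m::nat. \<nu> (a [^]\<^bsub>G\<^esub> m) / real m)"

end

theory Submission
  imports Defs
begin

text \<open>
  Write \<open>a\<^sub>i = g\<^bsup>x\<^sub>i\<^esup>\<close>, so that \<open>a\<^sub>1 \<cdots> a\<^sub>n = 1\<close>, and let \<open>D\<close> bound \<open>\<nu>\<close> on commutators of elements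
  of \<open>N\<close> and \<open>C\<close> bound it on the mixed commutators. Two comparisons give the estimate.

  Replacing each factor \<open>g\<^sup>m\<close> of \<open>g\<^bsup>mn\<^esup>\<close> by its conjugate \<open>a\<^sub>i\<^sup>m\<close> costs one mixed commutator, so
  \<open>\<nu> (g\<^bsup>mn\<^esup>)\<close> exceeds \<open>\<nu> (a\<^sub>1\<^sup>m \<cdots> a\<^sub>n\<^sup>m)\<close> by at most \<open>n C\<close>, an amount independent of \<open>m\<close>
  (\<open>nu_power_le_nu_conjugates\<close>).

  Pulling a power out of a product of two elements costs one commutator for every two steps of the
  exponent: \<open>a\<^bsup>m+2\<^esup> b\<^bsup>m+2\<^esup> (ab)\<^bsup>-(m+2)\<^esup>\<close> is conjugate to a single commutator times
  \<open>a\<^sup>m b\<^sup>m (ab)\<^bsup>-m\<^esup>\<close> (\<open>power_defect_step\<close>). This is where the factor \<open>1/2\<close> comes from. The relation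
  \<open>a\<^sub>1 = (a\<^sub>2 \<cdots> a\<^sub>n)\<^sup>-\<^sup>1\<close> makes \<open>a\<^sub>1\<^sup>m \<cdots> a\<^sub>n\<^sup>m\<close> conjugate to \<open>a\<^sub>2\<^sup>m \<cdots> a\<^sub>n\<^sup>m (a\<^sub>2 \<cdots> a\<^sub>n)\<^bsup>-m\<^esup>\<close>, and splitting the
  product of \<open>n - 1\<close> elements takes only \<open>n - 2\<close> such pairwise comparisons. Hence its norm is at most
  \<open>(n - 2) (m / 2) D\<close> up to a constant, for even \<open>m\<close>.

  Dividing by \<open>m n\<close> and letting \<open>m\<close> grow yields the bound along the exponents \<open>m n\<close>, and
  this decides the whole limit because the limit exists by Fekete's lemma (\<open>fekete\<close>).
\<close>

section \<open>Subadditive sequences\<close>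

lemma subadditive_mult_le:
  fixes f :: "nat \<Rightarrow> real"
  assumes sub: "\<And>i j. f (i + j) \<le> f i + f j"
  shows "f (q * d + r) \<le> real q * f d + f r"
proof (induction q)
  case (Suc q)
  have "f (Suc q * d + r) \<le> f d + f (q * d + r)"
    using sub[of d "q * d + r"] by (simp add: algebra_simps)
  with Suc show ?case by (simp add: algebra_simps)
qed simp

text \<open>
  The limit is the infimum of the quotients. Division with remainder by a fixed \<open>d\<close> shows that the
  quotients eventually drop below any number exceeding \<open>f d / d\<close>, since the finitely many
  remainders contribute a bounded amount.
\<close>

lemma fekete:
  fixes f :: "nat \<Rightarrow> real"
  assumes nonneg: "\<And>i. 0 \<le> f i" and sub: "\<And>i j. f (i + j) \<le> f i + f j"
  shows "convergent (\<lambda>m. f m / real m)"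
proof -
  define L where "L = (INF m\<in>{1..}. f m / real m)"
  have bdd: "bdd_below ((\<lambda>m. f m / real m) ` {1..})"
    by (rule bdd_belowI2[of _ 0]) (simp add: nonneg)
  have "(\<lambda>m. f m / real m) \<longlonglongrightarrow> L"
  proof (rule order_tendstoI)
    fix e assume "e < L"
    have "\<forall>m\<ge>1. e < f m / real m"
      using \<open>e < L\<close> cINF_lower[OF bdd] unfolding L_def by fastforce
    then show "\<forall>\<^sub>F m in sequentially. e < f m / real m"
      by (auto simp: eventually_sequentially)
  next
    fix e assume "L < e"
    then obtain d where d: "d \<ge> 1" "f d / real d < e"
      unfolding L_def using cINF_less_iff[OF _ bdd] by auto
    define B where "B = Max (f ` {..<d})"
    have rem: "f (m mod d) \<le> B" for m
      unfolding B_def using d by (intro Max_ge) auto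
    have upper: "f m / real m \<le> f d / real d + B / real m" if "m \<ge> 1" for m
    proof -
      have "f m \<le> real (m div d) * f d + f (m mod d)"
        using subadditive_mult_le[OF sub, of "m div d" d "m mod d"] by simp
      also have "\<dots> \<le> real m / real d * f d + B"
        using rem nonneg of_nat_div_le_of_nat[of m d] by (intro add_mono mult_right_mono) auto
      finally show ?thesis using that d by (simp add: field_simps)
    qed
    have "(\<lambda>m. f d / real d + B / real m) \<longlonglongrightarrow> f d / real d + 0"
      by (intro tendsto_intros lim_const_over_n)
    then have "\<forall>\<^sub>F m in sequentially. f d / real d + B / real m < e"
      using d by (auto dest: order_tendstoD(2))
    then show "\<forall>\<^sub>F m in sequentially. f m / real m < e"
      using eventually_ge_at_top[of 1] by eventually_elim (use upper in fastforce)
  qed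
  then show ?thesis by (rule convergentI)
qed

section \<open>Powers of a product\<close>

context group
begin

lemma inv_cancel_left [simp]:
  assumes "x \<in> carrier G" "y \<in> carrier G"
  shows "inv x \<otimes> (x \<otimes> y) = y" "x \<otimes> (inv x \<otimes> y) = y"
  using assms by (simp_all flip: m_assoc)

lemma comm_closed [simp]:
  "x \<in> carrier G \<Longrightarrow> y \<in> carrier G \<Longrightarrow> comm G x y \<in> carrier G"
  by (simp add: comm_def)

lemma conj_by_closed [simp]:
  "x \<in> carrier G \<Longrightarrow> y \<in> carrier G \<Longrightarrow> conj_by G x y \<in> carrier G"
  by (simp add: conj_by_def)

lemma conj_by_pow:
  assumes "x \<in> carrier G" "y \<in> carrier G"
  shows "conj_by G x y [^] (m::nat) = conj_by G x (y [^] m)"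
  using assms by (induction m) (simp_all add: conj_by_def m_assoc)

lemma conj_by_inverse [simp]:
  assumes "x \<in> carrier G" "y \<in> carrier G"
  shows "conj_by G (inv x) (conj_by G x y) = y"
  using assms by (simp add: conj_by_def m_assoc)

lemma conj_by_eq_comm_mult:
  assumes "x \<in> carrier G" "y \<in> carrier G"
  shows "conj_by G x y = comm G x y \<otimes> y"
  using assms by (simp add: conj_by_def comm_def m_assoc)

definition power_defect :: "'a \<Rightarrow> 'a \<Rightarrow> nat \<Rightarrow> 'a" where
  "power_defect a b m = a [^] m \<otimes> b [^] m \<otimes> inv ((a \<otimes> b) [^] m)"

text \<open>
  With \<open>P = a\<^sup>m b\<^sup>m\<close>, \<open>Q = (ab)\<^bsup>-m\<^esup>\<close> and \<open>u = b\<^sup>-\<^sup>1 a\<close>, the conjugate of \<open>a\<^sup>2 P b\<^sup>2 (ab)\<^sup>-\<^sup>1 Q (ab)\<^sup>-\<^sup>1\<close> by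
  \<open>(ab)\<^sup>-\<^sup>1\<close> is the word \<open>b\<^sup>-\<^sup>1 a P b a\<^sup>-\<^sup>1 Q = u (P b) u\<^sup>-\<^sup>1 (P b)\<^sup>-\<^sup>1 P Q\<close>.
\<close>

lemma power_defect_step:
  assumes a: "a \<in> carrier G" and b: "b \<in> carrier G"
  shows "power_defect a b (Suc (Suc m)) = conj_by G (a \<otimes> b)
    (comm G (inv b \<otimes> a) (a [^] m \<otimes> b [^] Suc m) \<otimes> power_defect a b m)"
proof -
  have "(a \<otimes> b) [^] Suc (Suc m) = a \<otimes> b \<otimes> (a \<otimes> b) [^] m \<otimes> (a \<otimes> b)"
    using assms by (metis m_closed nat_pow_Suc nat_pow_Suc2)
  moreover have "a [^] Suc (Suc m) = a \<otimes> (a \<otimes> a [^] m)"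
    using assms by (metis nat_pow_closed nat_pow_Suc2)
  ultimately show ?thesis
    using assms
    by (simp add: power_defect_def conj_by_def comm_def m_assoc inv_mult_group)
qed

abbreviation gprod :: "'a list \<Rightarrow> 'a" where
  "gprod as \<equiv> foldr (\<otimes>) as \<one>"

end

section \<open>Invariant norms\<close>

text \<open>The numbers \<open>D\<close> and \<open>C\<close> stand for the two suprema of \<open>\<nu>\<close> over commutators, or any upper bounds.\<close>

locale comm_bounded_norm = normal N G for N and G (structure) +
  fixes \<nu> :: "'a \<Rightarrow> real" and C D :: real
  assumes norm: "norm_on G N \<nu>"
    and inv_norm: "conj_invariant_on G N \<nu>"
    and mixed_bound: "\<And>x t. x \<in> carrier G \<Longrightarrow> t \<in> N \<Longrightarrow> \<nu> (comm G x t) \<le> C"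
    and bound: "\<And>t s. t \<in> N \<Longrightarrow> s \<in> N \<Longrightarrow> \<nu> (comm G t s) \<le> D"
begin

lemma nu_nonneg: "a \<in> N \<Longrightarrow> 0 \<le> \<nu> a"
  using norm by (simp add: norm_on_def)

lemma nu_mult_le: "a \<in> N \<Longrightarrow> b \<in> N \<Longrightarrow> \<nu> (a \<otimes> b) \<le> \<nu> a + \<nu> b"
  using norm by (simp add: norm_on_def)

lemma nu_conj_by: "a \<in> N \<Longrightarrow> x \<in> carrier G \<Longrightarrow> \<nu> (conj_by G x a) = \<nu> a"
  using inv_norm by (simp add: conj_invariant_on_def)

lemma conj_by_mem: "x \<in> carrier G \<Longrightarrow> a \<in> N \<Longrightarrow> conj_by G x a \<in> N"
  by (simp add: conj_by_def inv_op_closed2)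

lemma pow_mem: "a \<in> N \<Longrightarrow> a [^] (m::nat) \<in> N"
  by (induction m) simp_all

lemma comm_mem:
  assumes "x \<in> carrier G" "t \<in> N"
  shows "comm G x t \<in> N"
proof -
  have "comm G x t = conj_by G x t \<otimes> inv t"
    by (simp add: comm_def conj_by_def)
  then show ?thesis using assms by (simp add: conj_by_mem)
qed

lemma gprod_mem: "set as \<subseteq> N \<Longrightarrow> gprod as \<in> N"
  by (induction as) simp_all

lemma nu_mult_commute:
  assumes "a \<in> N" "b \<in> N"
  shows "\<nu> (a \<otimes> b) = \<nu> (b \<otimes> a)"
proof -
  have "a \<otimes> b = conj_by G a (b \<otimes> a)"
    using assms by (simp add: conj_by_def m_assoc)
  then show ?thesis using assms by (simp add: nu_conj_by)
qed

lemma power_defect_mem: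
  "a \<in> N \<Longrightarrow> b \<in> N \<Longrightarrow> power_defect a b m \<in> N"
  by (simp add: power_defect_def pow_mem)

lemma nu_power_defect:
  assumes a: "a \<in> N" and b: "b \<in> N"
  shows "\<nu> (power_defect a b (2 * k)) \<le> real k * D + \<nu> \<one>"
proof (induction k)
  case 0
  then show ?case using assms by (simp add: power_defect_def)
next
  case (Suc k)
  define c where "c = comm G (inv b \<otimes> a) (a [^] (2 * k) \<otimes> b [^] Suc (2 * k))"
  have mem: "inv b \<otimes> a \<in> N" "a [^] (2 * k) \<otimes> b [^] Suc (2 * k) \<in> N"
    using assms by (simp_all add: pow_mem)
  have c: "c \<in> N" "\<nu> c \<le> D"
    unfolding c_def using comm_mem[OF _ mem(2)] bound[OF mem] mem(1) by simp_all
  have "\<nu> (power_defect a b (2 * Suc k)) = \<nu> (c \<otimes> power_defect a b (2 * k))"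
    using assms c power_defect_step[of a b "2 * k"]
    by (simp add: c_def nu_conj_by power_defect_mem del: nat_pow_Suc)
  also have "\<dots> \<le> D + (real k * D + \<nu> \<one>)"
    using nu_mult_le[OF c(1) power_defect_mem[OF a b, of "2 * k"]] c(2) Suc by linarith
  finally show ?case by (simp add: algebra_simps)
qed

text \<open>
  Splitting off the first factor costs one \<open>power_defect\<close> and leaves a conjugate of the same
  expression for the remaining factors; a single factor has no defect, so only \<open>length as - 1\<close> splittings occur. The terms
  with \<open>\<nu> \<one>\<close> are there because the norm of the identity may be positive.
\<close>

lemma nu_gprod_powers:
  assumes "as \<noteq> []" "set as \<subseteq> N"
  shows "\<nu> (gprod (map (\<lambda>a. a [^] (2 * k)) as) \<otimes> inv (gprod as [^] (2 * k)))
    \<le> (real (length as) - 1) * (real k * D + \<nu> \<one>) + \<nu> \<one>"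
  using assms
proof (induction as rule: list_nonempty_induct)
  case (single a)
  then show ?case by simp
next
  case (cons a as)
  define T where "T = gprod (map (\<lambda>a. a [^] (2 * k)) as)"
  define b where "b = gprod as"
  have a: "a \<in> N" and as: "set as \<subseteq> N" using cons.prems by auto
  have mem: "T \<in> N" "b \<in> N"
    unfolding T_def b_def using as by (auto intro!: gprod_mem pow_mem)
  have ak: "a [^] (2 * k) \<in> N" "b [^] (2 * k) \<in> N" using a mem by (simp_all add: pow_mem)
  have "a [^] (2 * k) \<otimes> T \<otimes> inv ((a \<otimes> b) [^] (2 * k))
      = conj_by G (a [^] (2 * k)) (T \<otimes> inv (b [^] (2 * k))) \<otimes> power_defect a b (2 * k)"
    using a mem by (simp add: conj_by_def power_defect_def m_assoc)
  then have "\<nu> (a [^] (2 * k) \<otimes> T \<otimes> inv ((a \<otimes> b) [^] (2 * k)))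
      \<le> \<nu> (T \<otimes> inv (b [^] (2 * k))) + \<nu> (power_defect a b (2 * k))"
    using nu_mult_le[of "conj_by G (a [^] (2 * k)) (T \<otimes> inv (b [^] (2 * k)))" "power_defect a b (2 * k)"]
      a mem ak by (simp add: conj_by_mem nu_conj_by power_defect_mem)
  also have "\<dots> \<le> (real (length as) - 1) * (real k * D + \<nu> \<one>) + \<nu> \<one> + (real k * D + \<nu> \<one>)"
    using cons.IH[OF as] nu_power_defect[OF a mem(2)] unfolding T_def b_def by (rule add_mono)
  finally show ?case by (simp add: T_def b_def algebra_simps)
qed

text \<open>
  The first factor is the inverse of the product of the others, so that no splitting is needed
  for it; this is what improves \<open>n - 1\<close> to \<open>n - 2\<close>.
\<close>

lemma nu_gprod_powers_of_relation:
  assumes "set as \<subseteq> N" "2 \<le> length as" "gprod as = \<one>"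
  shows "\<nu> (gprod (map (\<lambda>a. a [^] (2 * k)) as))
    \<le> (real (length as) - 2) * (real k * D + \<nu> \<one>) + \<nu> \<one>"
proof -
  obtain a bs where as: "as = a # bs" "bs \<noteq> []"
    using assms(2) by (cases as; cases "tl as") auto
  define T where "T = gprod (map (\<lambda>a. a [^] (2 * k)) bs)"
  define b where "b = gprod bs"
  have mem: "a \<in> N" "set bs \<subseteq> N" "T \<in> N" "b \<in> N"
    unfolding T_def b_def using assms(1) as by (auto intro!: gprod_mem pow_mem)
  have "a = inv b"
    using assms(3) as mem by (simp add: b_def inv_equality)
  then have "\<nu> (gprod (map (\<lambda>a. a [^] (2 * k)) as)) = \<nu> (inv (b [^] (2 * k)) \<otimes> T)"
    using mem by (simp add: as T_def nat_pow_inv)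
  also have "\<dots> = \<nu> (T \<otimes> inv (b [^] (2 * k)))"
    using mem by (simp add: nu_mult_commute pow_mem)
  also have "\<dots> \<le> (real (length bs) - 1) * (real k * D + \<nu> \<one>) + \<nu> \<one>"
    using nu_gprod_powers[OF as(2) mem(2)] by (simp add: T_def b_def)
  finally show ?thesis by (simp add: as)
qed

text \<open>
  The left factor \<open>y\<close> carries the powers already exchanged; the exchange of \<open>g\<^sup>m\<close> with a conjugate
  of it happens in the middle of a product, and conjugation moves the resulting commutator
  to the front.
\<close>

lemma nu_power_le_nu_conjugates:
  assumes "g \<in> N" "set xs \<subseteq> carrier G" "y \<in> N"
  shows "\<nu> (y \<otimes> g [^] (m * length xs))
    \<le> \<nu> (y \<otimes> gprod (map (\<lambda>x. conj_by G x g [^] m) xs)) + real (length xs) * C"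
  using assms(2,3)
proof (induction xs arbitrary: y)
  case (Cons x xs)
  define a where "a = conj_by G x g [^] m"
  define R where "R = gprod (map (\<lambda>x. conj_by G x g [^] m) xs)"
  define c where "c = comm G (inv x) a"
  have x: "x \<in> carrier G" and xs: "set xs \<subseteq> carrier G" using Cons.prems by auto
  have mem: "y \<in> N" "g [^] m \<in> N" "a \<in> N" "R \<in> N"
    unfolding a_def R_def using x xs assms(1) Cons.prems
    by (auto intro!: gprod_mem pow_mem conj_by_mem)
  have c: "c \<in> N" "\<nu> c \<le> C"
    unfolding c_def using x mem by (auto intro: comm_mem mixed_bound)
  have "g [^] m = conj_by G (inv x) a"
    using x assms(1) by (simp add: a_def conj_by_pow)
  then have exch: "g [^] m = c \<otimes> a"
    using x mem by (simp add: c_def conj_by_eq_comm_mult)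
  have "g [^] (m * length (x # xs)) = g [^] m \<otimes> g [^] (m * length xs)"
    using assms(1) by (simp add: nat_pow_mult)
  then have "\<nu> (y \<otimes> g [^] (m * length (x # xs))) = \<nu> ((y \<otimes> g [^] m) \<otimes> g [^] (m * length xs))"
    using mem assms(1) by (simp add: m_assoc)
  also have "\<dots> \<le> \<nu> ((y \<otimes> g [^] m) \<otimes> R) + real (length xs) * C"
    unfolding R_def using mem by (intro Cons.IH xs) simp
  also have "(y \<otimes> g [^] m) \<otimes> R = conj_by G y c \<otimes> (y \<otimes> (a \<otimes> R))"
    unfolding exch using mem c by (simp add: conj_by_def m_assoc)
  also have "\<nu> \<dots> \<le> \<nu> c + \<nu> (y \<otimes> (a \<otimes> R))"
    using nu_mult_le[of "conj_by G y c" "y \<otimes> (a \<otimes> R)"] mem c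
    by (simp add: conj_by_mem nu_conj_by)
  finally show ?case
    using c(2) by (simp add: a_def R_def algebra_simps)
qed (use assms in simp)

lemma t_set_ge_2:
  assumes "g \<in> N" "g \<noteq> \<one>" "n \<in> t_set G g"
  shows "2 \<le> n"
proof (rule ccontr)
  assume "\<not> 2 \<le> n"
  moreover have "0 < n" using assms(3) by (simp add: t_set_def)
  ultimately have "n = Suc 0" by simp
  with assms(3) obtain x where x: "x \<in> carrier G" "conj_by G x g = \<one>"
    unfolding t_set_def using assms(1) by (auto simp: length_Suc_conv)
  then have "g = conj_by G (inv x) \<one>"
    using assms(1) conj_by_inverse[of x g] by simp
  then show False using assms(2) x by (simp add: conj_by_def)
qed

lemma nu_power_le:
  assumes g: "g \<in> N" "g \<noteq> \<one>" and n: "n \<in> t_set G g"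
  shows "\<nu> (g [^] (2 * k * n)) \<le> (real n - 2) * (real k * D + \<nu> \<one>) + \<nu> \<one> + real n * C"
proof -
  obtain xs where xs: "length xs = n" "set xs \<subseteq> carrier G"
    "gprod (map (\<lambda>x. conj_by G x g) xs) = \<one>"
    using n unfolding t_set_def by auto
  have mem: "set (map (\<lambda>x. conj_by G x g) xs) \<subseteq> N"
    using xs(2) g(1) conj_by_mem by auto
  have powers: "set (map (\<lambda>x. conj_by G x g [^] (2 * k)) xs) \<subseteq> N"
    using xs(2) g(1) by (auto intro!: conj_by_mem pow_mem)
  have "\<nu> (g [^] (2 * k * n))
      \<le> \<nu> (gprod (map (\<lambda>x. conj_by G x g [^] (2 * k)) xs)) + real n * C"
    using nu_power_le_nu_conjugates[OF g(1) xs(2) subgroup.one_closed[OF subgroup_axioms], of "2 * k"] xs(1) g(1)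
      gprod_mem[OF powers] by simp
  moreover have "\<nu> (gprod (map (\<lambda>x. conj_by G x g [^] (2 * k)) xs))
      \<le> (real n - 2) * (real k * D + \<nu> \<one>) + \<nu> \<one>"
    using nu_gprod_powers_of_relation[OF mem _ xs(3), of k] t_set_ge_2[OF g n] xs(1)
    by (simp add: comp_def)
  ultimately show ?thesis by linarith
qed

lemma stabilization_tendsto:
  assumes "a \<in> N"
  shows "(\<lambda>m. \<nu> (a [^] m) / real m) \<longlonglongrightarrow> stabilization G \<nu> a"
proof -
  have "convergent (\<lambda>m. \<nu> (a [^] m) / real m)"
  proof (rule fekete)
    show "0 \<le> \<nu> (a [^] i)" for i :: nat
      using assms by (simp add: nu_nonneg pow_mem)
    show "\<nu> (a [^] (i + j)) \<le> \<nu> (a [^] i) + \<nu> (a [^] j)" for i j :: nat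
      using assms nu_mult_le[of "a [^] i" "a [^] j"] by (simp add: nat_pow_mult pow_mem)
  qed
  then show ?thesis by (simp add: stabilization_def convergent_LIMSEQ_iff)
qed

lemma stabilization_le:
  assumes g: "g \<in> N" "g \<noteq> \<one>" and n: "n \<in> t_set G g"
  shows "stabilization G \<nu> g \<le> (real n - 2) / (2 * real n) * D"
proof -
  \<comment> \<open>The part of the bound on \<open>\<nu> (g\<^bsup>2kn\<^esup>)\<close> that does not grow with \<open>k\<close>, divided by \<open>2n\<close>.\<close>
  define E where "E = ((real n - 2) * \<nu> \<one> + \<nu> \<one> + real n * C) / (2 * real n)"
  have n2: "2 \<le> n" by (rule t_set_ge_2[OF g n])
  have "strict_mono (\<lambda>k. 2 * k * n)"
    using n2 by (intro strict_monoI) simp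
  then have lim: "(\<lambda>k. \<nu> (g [^] (2 * k * n)) / real (2 * k * n)) \<longlonglongrightarrow> stabilization G \<nu> g"
    using LIMSEQ_subseq_LIMSEQ[OF stabilization_tendsto[OF g(1)]] by (simp only: comp_def)
  have lim': "(\<lambda>k. (real n - 2) / (2 * real n) * D + E / real k)
      \<longlonglongrightarrow> (real n - 2) / (2 * real n) * D + 0"
    by (intro tendsto_intros lim_const_over_n)
  have "\<nu> (g [^] (2 * k * n)) / real (2 * k * n) \<le> (real n - 2) / (2 * real n) * D + E / real k"
    if "k \<ge> 1" for k
  proof -
    have "\<nu> (g [^] (2 * k * n)) / real (2 * k * n)
        \<le> ((real n - 2) * (real k * D + \<nu> \<one>) + \<nu> \<one> + real n * C) / real (2 * k * n)"
      by (intro divide_right_mono nu_power_le[OF g n]) simp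
    also have "\<dots> = (real n - 2) / (2 * real n) * D + E / real k"
      using that n2 by (simp add: E_def field_simps)
    finally show ?thesis .
  qed
  then have "stabilization G \<nu> g \<le> (real n - 2) / (2 * real n) * D + 0"
    by (intro LIMSEQ_le[OF lim lim']) blast
  then show ?thesis by simp
qed

end

theorem theorem3p7:
  fixes G :: "('a, 'b) monoid_scheme" and N :: "'a set" and \<nu> :: "'a \<Rightarrow> real"
    and g :: 'a and n :: nat
  assumes "group G"
    and "N \<lhd> G"
    and "g \<in> N" and "g \<noteq> \<one>\<^bsub>G\<^esub>"
    and "n \<in> t_set G g"
    and "norm_on G N \<nu>"
    and "conj_invariant_on G N \<nu>"
    and "bdd_above {\<nu> (comm G x t) | x t. x \<in> carrier G \<and> t \<in> N}"
  shows "stabilization G \<nu> g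
    \<le> (real n - 2) / (2 * real n) * Sup {\<nu> (comm G t s) | t s. t \<in> N \<and> s \<in> N}"
proof -
  let ?M = "{\<nu> (comm G x t) | x t. x \<in> carrier G \<and> t \<in> N}"
  let ?S = "{\<nu> (comm G t s) | t s. t \<in> N \<and> s \<in> N}"
  interpret normal N G by (rule assms(2))
  have bdd: "bdd_above ?S"
    by (rule bdd_above_mono[OF assms(8)]) (use subset in blast)
  interpret comm_bounded_norm N G \<nu> "Sup ?M" "Sup ?S"
  proof unfold_locales
    show "\<nu> (comm G x t) \<le> Sup ?M" if "x \<in> carrier G" "t \<in> N" for x t
      by (rule cSup_upper[OF _ assms(8)]) (use that in blast)
    show "\<nu> (comm G t s) \<le> Sup ?S" if "t \<in> N" "s \<in> N" for t s
      by (rule cSup_upper[OF _ bdd]) (use that in blast)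
  qed (rule assms)+
  show ?thesis by (rule stabilization_le[OF assms(3-5)])
qed

end
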